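(* $\tau(\mathrm{PSG}_4)=10$ and $a(\mathrm{PSG}_4)=4!-\tau(\mathrm{PSG}_4)=14$.
   Context: Two lists $(a_1,\ldots,a_s)$ and $(b_1,\ldots,b_s)$, each with distinct entries, pattern-match if for all $i<j$ we have $a_i<a_j$ if and only if $b_i<b_j$. The pattern-shift graph $\mathrm{PSG}_r$ is the digraph (loops allowed) whose vertices are the permutations of $[r]=\{1,\ldots,r\}$ written as lists, with an edge from $a$ to $b$ (possibly $a=b$) if and only if the list of the last $r-1$ entries of $a$ and the list of the first $r-1$ entries of $b$ pattern-match. For a digraph $G$, $\tau(G)$ is the minimum size of a set of vertices which intersects every directed cycle in $G$, and $a(G)$ is the maximum size of a set of vertices inducing an acyclic subgraph, i.e. one with no directed cycle. Loops count as cycles of length 1, and directed 2-cycles count as cycles. *)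

theory Defs
  imports "Graph_Theory.Graph_Theory" "HOL-Combinatorics.Multiset_Permutations"
begin

text \<open>Intended for lists with distinct entries.  This is not part of the definition, as all
  lists occurring below are sublists of permutations.\<close>

definition pattern_match :: "'a::linorder list \<Rightarrow> 'b::linorder list \<Rightarrow> bool" where
  "pattern_match a b \<longleftrightarrow> length a = length b \<and>
     (\<forall>i j. i < j \<and> j < length a \<longrightarrow> (a ! i < a ! j \<longleftrightarrow> b ! i < b ! j))"

text \<open>A vertex has length \<open>r\<close>, so its last and first \<open>r - 1\<close> entries are its \<open>tl\<close> and
  its \<open>butlast\<close>.\<close>

definition PSG :: "nat \<Rightarrow> (nat list, nat list \<times> nat list) pre_digraph" where
  "PSG r = \<lparr>verts = permutations_of_set {1..r},
     arcs = {(a, b). a \<in> permutations_of_set {1..r} \<and> b \<in> permutations_of_set {1..r} \<and>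
                     pattern_match (tl a) (butlast b)},
     tail = fst, head = snd\<rparr>"

lemma fin_digraph_PSG: "fin_digraph (PSG r)"
proof
  have "arcs (PSG r) \<subseteq> permutations_of_set {1..r} \<times> permutations_of_set {1..r}"
    by (auto simp: PSG_def)
  then show "finite (arcs (PSG r))"
    by (rule finite_subset) simp
qed (auto simp: PSG_def)

text \<open>Cycles are those of \<^const>\<open>pre_digraph.cycle\<close>: nonempty closed arc walks without
  repeated vertices, with loops and 2-cycles included.  The vertices of a cycle \<open>p\<close> are
  exactly the tails of its arcs.\<close>

definition meets_all_cycles :: "('a, 'b) pre_digraph \<Rightarrow> 'a set \<Rightarrow> bool" where
  "meets_all_cycles G S \<longleftrightarrow> (\<forall>p. pre_digraph.cycle G p \<longrightarrow> S \<inter> tail G ` set p \<noteq> {})"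

definition acyclic_digraph :: "('a, 'b) pre_digraph \<Rightarrow> bool" where
  "acyclic_digraph G \<longleftrightarrow> \<not> (\<exists>p. pre_digraph.cycle G p)"

text \<open>\<^const>\<open>Min\<close> and \<^const>\<open>Max\<close> are meaningful because the digraph is meant to be finite;
  both sets are nonempty (take \<open>S = verts G\<close> and \<open>S = {}\<close>).\<close>

definition cycle_transversal_number :: "('a, 'b) pre_digraph \<Rightarrow> nat" where
  "cycle_transversal_number G = Min {card S | S. S \<subseteq> verts G \<and> meets_all_cycles G S}"

definition max_acyclic_number :: "('a, 'b) pre_digraph \<Rightarrow> nat" where
  "max_acyclic_number G = Max {card S | S. S \<subseteq> verts G \<and> acyclic_digraph (G \<restriction> S)}"

end

theory Submission
  imports Defs
begin

text \<open>A vertex \<open>v\<close> of \<open>PSG\<^sub>4\<close> can be seen as an arc from the pattern of its first three entries to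
  the pattern of its last three; then cycles of \<open>PSG\<^sub>4\<close> are closed trails in a multigraph on the six
  patterns of length 3. Order these patterns linearly: the vertices that go forward induce an
  acyclic subgraph, and a good order leaves only 10 other vertices. Conversely, \<open>PSG\<^sub>4\<close>
  contains 10 pairwise disjoint cycles.\<close>

section \<open>Cycle transversals and acyclic induced subgraphs\<close>

context wf_digraph begin

text \<open>Around a closed walk every head is the tail of the cyclically next arc, so the tails
  already give all vertices. This justifies testing cycles by their tails alone.\<close>

lemma awalk_verts_closed:
  assumes "awalk u p u" "p \<noteq> []"
  shows "set (awalk_verts u p) = tail G ` set p"
proof -
  have "set (awalk_verts u p) = {u} \<union> tail G ` set p \<union> head G ` set p"
    using assms by (auto simp: set_awalk_verts)
  moreover have "set (awalk_verts u p) = insert u (tail G ` set p)"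
    using assms by (auto simp: awalk_verts_conv dest: awlast_of_awalk)
  moreover have "u \<in> tail G ` set p"
    using assms by (cases p) (auto simp: awalk_Cons_iff)
  ultimately show ?thesis by auto
qed

lemma cycle_induce_subgraph_iff:
  assumes "V \<subseteq> verts G"
  shows "pre_digraph.cycle (G \<restriction> V) p \<longleftrightarrow> cycle p \<and> tail G ` set p \<subseteq> V"
proof
  assume *: "pre_digraph.cycle (G \<restriction> V) p"
  have "set p \<subseteq> arcs (G \<restriction> V)"
    using * by (auto simp: pre_digraph.cycle_def pre_digraph.awalk_def)
  then show "cycle p \<and> tail G ` set p \<subseteq> V"
    using subgraph_cycle[OF subgraph_induce_subgraphI[OF assms] *] by auto
next
  assume *: "cycle p \<and> tail G ` set p \<subseteq> V"
  then obtain u where u: "awalk u p u" "distinct (tl (awalk_verts u p))" "p \<noteq> []"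
    by (auto simp: cycle_def)
  then have "pre_digraph.awalk (G \<restriction> V) u p u"
    using * by (intro awalk_induce) (auto simp: awalk_verts_closed)
  then show "pre_digraph.cycle (G \<restriction> V) p"
    using u by (auto simp: pre_digraph.cycle_def awalk_verts_induce)
qed

text \<open>A cycle survives in \<open>G \<restriction> V\<close> exactly when it avoids the
  complement of \<open>V\<close>.\<close>

lemma acyclic_induce_subgraph_iff:
  assumes "V \<subseteq> verts G"
  shows "acyclic_digraph (G \<restriction> V) \<longleftrightarrow> meets_all_cycles G (verts G - V)"
proof -
  have "tail G ` set p \<subseteq> verts G" if "cycle p" for p
    using that by (auto simp: cycle_def awalk_def)
  then show ?thesis
    using assms by (fastforce simp: acyclic_digraph_def meets_all_cycles_def cycle_induce_subgraph_iff)
qed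

lemma awalk_potential_less:
  fixes f :: "'a \<Rightarrow> 'c::order"
  assumes "awalk u p v" "p \<noteq> []"
    and "\<And>e. e \<in> set p \<Longrightarrow> f (tail G e) < f (head G e)"
  shows "f u < f v"
  using assms
proof (induction p arbitrary: u)
  case (Cons e p)
  then have "f u < f (head G e)" "awalk (head G e) p v"
    by (auto simp: awalk_Cons_iff)
  then show ?case
    using Cons by (cases "p = []") (auto simp: awalk_Nil_iff intro: less_trans)
qed simp

text \<open>Around a cycle avoiding \<open>S\<close> the potential \<open>f\<close> would rise along
  every arc and yet return to its initial value.\<close>

lemma meets_all_cycles_potential:
  fixes f :: "'a \<Rightarrow> 'c::order"
  assumes "\<And>e. e \<in> arcs G \<Longrightarrow> tail G e \<notin> S \<Longrightarrow> f (tail G e) < f (head G e)"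
  shows "meets_all_cycles G S"
  unfolding meets_all_cycles_def
proof (intro allI impI notI)
  fix p assume "cycle p" and disj: "S \<inter> tail G ` set p = {}"
  then obtain u where u: "awalk u p u" "p \<noteq> []" by (auto simp: cycle_def)
  then have "set p \<subseteq> arcs G" by auto
  then have "f u < f u"
    using disj by (intro awalk_potential_less[OF u] assms) auto
  then show False by simp
qed

end

context fin_digraph begin

lemma finite_cards_subset: "finite {card S | S. S \<subseteq> verts G \<and> P S}"
proof -
  have "{card S | S. S \<subseteq> verts G \<and> P S} \<subseteq> card ` Pow (verts G)" by auto
  then show ?thesis by (rule finite_subset) simp
qed

lemma cycle_transversal_number_witness:
  obtains S where "S \<subseteq> verts G" "meets_all_cycles G S" "card S = cycle_transversal_number G"
proof -
  \<comment> \<open>No arc has its tail outside \<open>verts G\<close>, so a constant potential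
    serves. This makes the set under \<open>Min\<close> nonempty.\<close>
  have "meets_all_cycles G (verts G)"
    by (intro meets_all_cycles_potential[where f = "\<lambda>_. 0 :: nat"]) auto
  then have "cycle_transversal_number G \<in> {card S | S. S \<subseteq> verts G \<and> meets_all_cycles G S}"
    unfolding cycle_transversal_number_def
    by (intro Min_in finite_cards_subset) auto
  then show thesis using that by auto
qed

lemma cycle_transversal_number_le:
  "S \<subseteq> verts G \<Longrightarrow> meets_all_cycles G S \<Longrightarrow> cycle_transversal_number G \<le> card S"
  unfolding cycle_transversal_number_def by (intro Min_le finite_cards_subset) auto

text \<open>Complementation exchanges transversals with acyclic vertex sets, so it takes a smallest
  one of the former to a largest one of the latter.\<close>

theorem max_acyclic_number_eq:
  "max_acyclic_number G = card (verts G) - cycle_transversal_number G"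
  unfolding max_acyclic_number_def
proof (rule Max_eqI[OF finite_cards_subset])
  fix k assume "k \<in> {card V | V. V \<subseteq> verts G \<and> acyclic_digraph (G \<restriction> V)}"
  then obtain V where V: "k = card V" "V \<subseteq> verts G" "acyclic_digraph (G \<restriction> V)"
    by auto
  then have "cycle_transversal_number G \<le> card (verts G - V)"
    by (intro cycle_transversal_number_le) (auto simp: acyclic_induce_subgraph_iff)
  then show "k \<le> card (verts G) - cycle_transversal_number G"
    using V card_mono[of "verts G" V] by (simp add: card_Diff_subset finite_subset)
next
  obtain S where S: "S \<subseteq> verts G" "meets_all_cycles G S" "card S = cycle_transversal_number G"
    by (rule cycle_transversal_number_witness)
  have "verts G - (verts G - S) = S" using S by auto
  then have "acyclic_digraph (G \<restriction> (verts G - S))"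
    using S by (simp add: acyclic_induce_subgraph_iff)
  then show "card (verts G) - cycle_transversal_number G
      \<in> {card V | V. V \<subseteq> verts G \<and> acyclic_digraph (G \<restriction> V)}"
    using S by (auto simp: card_Diff_subset finite_subset intro!: exI[of _ "verts G - S"])
qed

end

text \<open>Packing bound: disjoint lists need separate elements of \<open>S\<close>. Disjointness
  is encoded by \<open>distinct (concat vss)\<close>.\<close>

lemma length_le_card_hitting_set:
  assumes "finite S" "distinct (concat vss)" "\<And>vs. vs \<in> set vss \<Longrightarrow> S \<inter> set vs \<noteq> {}"
  shows "length vss \<le> card S"
  using assms
proof (induction vss arbitrary: S)
  case (Cons vs vss)
  \<comment> \<open>Deleting \<open>vs\<close> takes at least one element from \<open>S\<close>, but
    none that hits a later list.\<close>
  have "(S - set vs) \<inter> set ws \<noteq> {}" if "ws \<in> set vss" for ws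
  proof -
    have "set vs \<inter> set ws = {}" using Cons.prems(2) that by auto
    then show ?thesis using Cons.prems(3)[of ws] that by auto
  qed
  then have "length vss \<le> card (S - set vs)"
    using Cons.prems by (intro Cons.IH) auto
  also have "\<dots> < card S"
    using Cons.prems by (intro psubset_card_mono) auto
  finally show ?case by simp
qed simp

context
  fixes G :: "('a, 'a \<times> 'a) pre_digraph"
  assumes ends: "tail G = fst" "head G = snd"
begin

lemma cas_zip: "pre_digraph.cas G x (zip (x # xs) (xs @ [y])) y"
  by (induction xs arbitrary: x) (simp_all add: pre_digraph.cas.simps ends)

text \<open>Zipping with \<open>rotate1\<close> pairs each vertex with its cyclic successor, so a
  cycle can be given by its vertex list; a singleton list gives a loop.\<close>

lemma cycle_zip_rotate1:
  assumes "wf_digraph G" "vs \<noteq> []" "distinct vs" "set (zip vs (rotate1 vs)) \<subseteq> arcs G"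
  shows "pre_digraph.cycle G (zip vs (rotate1 vs))"
proof -
  interpret wf_digraph G by fact
  obtain x xs where vs: "vs = x # xs" using assms(2) by (cases vs) auto
  let ?p = "zip (x # xs) (xs @ [x])"
  have cas: "cas x ?p x" by (rule cas_zip)
  have ne: "?p \<noteq> []" by (cases xs) auto
  have arcs: "set ?p \<subseteq> arcs G" using assms(4) vs by simp
  have "x \<in> verts G"
    using arcs cas ne tail_in_verts by (cases ?p) auto
  \<comment> \<open>After the start, the walk visits the heads \<open>xs @ [x]\<close>, a rotation
    of \<open>vs\<close>.\<close>
  moreover have "distinct (tl (awalk_verts x ?p))"
    using awalk_verts_conv'[OF cas] ne assms(3) vs by (simp add: ends del: zip_Cons_Cons)
  ultimately show ?thesis
    using cas ne arcs vs by (auto simp: cycle_def awalk_def)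
qed

lemma meets_all_cycles_closed_list:
  assumes "wf_digraph G" "meets_all_cycles G S"
    and "vs \<noteq> []" "distinct vs" "set (zip vs (rotate1 vs)) \<subseteq> arcs G"
  shows "S \<inter> set vs \<noteq> {}"
proof -
  have "tail G ` set (zip vs (rotate1 vs)) = set vs"
    by (simp add: ends flip: set_map)
  then show ?thesis
    using assms(2) cycle_zip_rotate1[OF assms(1,3-5)] unfolding meets_all_cycles_def by metis
qed

end

section \<open>The graph \<open>PSG\<^sub>4\<close>\<close>

lemma verts_PSG: "verts (PSG r) = permutations_of_set {1..r}"
  by (simp add: PSG_def)

lemma pattern_match_nth:
  "pattern_match a b \<Longrightarrow> i < j \<Longrightarrow> j < length a \<Longrightarrow> a ! i < a ! j \<longleftrightarrow> b ! i < b ! j"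
  by (simp add: pattern_match_def)

text \<open>Quantifiers ranging over explicit lists make the relation executable by
  \<open>code_simp\<close>.\<close>

lemma pattern_match_code:
  "pattern_match a b \<longleftrightarrow> length a = length b \<and>
     (\<forall>j\<in>set [0..<length a]. \<forall>i\<in>set [0..<j]. (a ! i < a ! j \<longleftrightarrow> b ! i < b ! j))"
  by (auto simp: pattern_match_def)

lemma permutations_1_4:
  "permutations_of_set {1..4::nat} = set (permutations_of_set_list [1, 2, 3, 4 :: nat])"
proof -
  have "{1..4::nat} = set [1, 2, 3, 4]" by auto
  then show ?thesis by (simp only: permutations_of_list) simp
qed

text \<open>The position of the pattern of a list of length 3 in the order 123, 132, 231, 321, 213, 312.\<close>

definition pattern_rank :: "nat list \<Rightarrow> nat" where
  "pattern_rank a =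
     (if a ! 0 < a ! 1 then if a ! 1 < a ! 2 then 0 else if a ! 0 < a ! 2 then 1 else 2
      else if a ! 1 < a ! 2 then if a ! 0 < a ! 2 then 4 else 5 else 3)"

text \<open>The rank reads only comparisons at positions \<open>i < j\<close>, and
  \<open>pattern_match\<close> preserves these.\<close>

lemma pattern_rank_cong:
  "pattern_match a b \<Longrightarrow> length a = 3 \<Longrightarrow> pattern_rank a = pattern_rank b"
  using pattern_match_nth[of a b 0 1] pattern_match_nth[of a b 0 2] pattern_match_nth[of a b 1 2]
  by (simp add: pattern_rank_def)

text \<open>Equality of ranks is included because a vertex whose two patterns agree has a
  loop.\<close>

definition backward_vertices :: "nat list set" where
  "backward_vertices =
     {v \<in> verts (PSG 4). pattern_rank (tl v) \<le> pattern_rank (butlast v)}"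

lemma card_backward_vertices: "card backward_vertices = 10"
proof -
  have "backward_vertices = set (filter (\<lambda>v. pattern_rank (tl v) \<le> pattern_rank (butlast v))
      (permutations_of_set_list [1, 2, 3, 4 :: nat]))"
    unfolding backward_vertices_def verts_PSG permutations_1_4 by (simp only: set_filter)
  moreover have "card \<dots> = 10" by code_simp
  ultimately show ?thesis by simp
qed

text \<open>The potential is the rank of a vertex's first pattern. Along an arc
  \<open>(a, b)\<close> its value at \<open>b\<close> is the rank of \<open>tl a\<close>, which
  exceeds the value at \<open>a\<close> unless \<open>a\<close> is backward.\<close>

lemma meets_all_cycles_backward_vertices: "meets_all_cycles (PSG 4) backward_vertices"
proof (rule wf_digraph.meets_all_cycles_potential[where f = "\<lambda>v. pattern_rank (butlast v)"])
  show "wf_digraph (PSG 4)" using fin_digraph_PSG by (rule fin_digraph.axioms)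
next
  fix e assume e: "e \<in> arcs (PSG 4)" "tail (PSG 4) e \<notin> backward_vertices"
  obtain a b where ab: "e = (a, b)" by (cases e)
  have "length a = 4"
    using e ab by (auto simp: PSG_def dest: length_finite_permutations_of_set)
  then have "pattern_rank (tl a) = pattern_rank (butlast b)"
    using e ab by (intro pattern_rank_cong) (auto simp: PSG_def)
  then show "pattern_rank (butlast (tail (PSG 4) e)) < pattern_rank (butlast (head (PSG 4) e))"
    using e ab by (auto simp: PSG_def backward_vertices_def)
qed

text \<open>Each inner list is read cyclically: two loops, two 2-cycles and six 3-cycles. Since 2 +
  4 + 18 = 24, they use up all vertices.\<close>

definition disjoint_cycles :: "nat list list list" where
  "disjoint_cycles =
    [[[1,2,3,4]],
     [[4,3,2,1]],
     [[1,3,2,4], [3,1,4,2]],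
     [[2,4,1,3], [4,2,3,1]],
     [[1,4,2,3], [4,1,2,3], [1,2,4,3]],
     [[3,1,2,4], [1,3,4,2], [3,4,1,2]],
     [[1,4,3,2], [4,2,1,3], [2,1,4,3]],
     [[2,1,3,4], [2,3,4,1], [2,3,1,4]],
     [[4,3,1,2], [4,1,3,2], [2,4,3,1]],
     [[3,4,2,1], [3,2,1,4], [3,2,4,1]]]"

lemma distinct_disjoint_cycles:
  "distinct (concat disjoint_cycles)" "[] \<notin> set disjoint_cycles" "length disjoint_cycles = 10"
  by (simp_all add: disjoint_cycles_def)

lemma arcs_disjoint_cycles:
  assumes "vs \<in> set disjoint_cycles"
  shows "set (zip vs (rotate1 vs)) \<subseteq> arcs (PSG 4)"
proof -
  have "\<forall>vs\<in>set disjoint_cycles. \<forall>(a, b)\<in>set (zip vs (rotate1 vs)).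
      a \<in> permutations_of_set {1..4} \<and> b \<in> permutations_of_set {1..4} \<and>
      pattern_match (tl a) (butlast b)"
    unfolding pattern_match_code permutations_1_4 by code_simp
  then have "\<forall>(a, b)\<in>set (zip vs (rotate1 vs)). a \<in> permutations_of_set {1..4} \<and>
      b \<in> permutations_of_set {1..4} \<and> pattern_match (tl a) (butlast b)"
    using assms by (rule bspec)
  then show ?thesis by (auto simp: PSG_def)
qed

lemma cycle_transversal_number_PSG_4: "cycle_transversal_number (PSG 4) = 10"
proof -
  interpret fin_digraph "PSG 4" by (rule fin_digraph_PSG)
  obtain S where S: "S \<subseteq> verts (PSG 4)" "meets_all_cycles (PSG 4) S"
      "card S = cycle_transversal_number (PSG 4)"
    by (rule cycle_transversal_number_witness)
  \<comment> \<open>A minimum transversal \<open>S\<close> meets each of the ten cycles, and the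
    packing bound then gives the lower bound; \<open>backward_vertices\<close> attains it.\<close>
  have "S \<inter> set vs \<noteq> {}" if "vs \<in> set disjoint_cycles" for vs
  proof (rule meets_all_cycles_closed_list[OF _ _ wf_digraph_axioms S(2)])
    show "vs \<noteq> []" using that distinct_disjoint_cycles(2) by auto
    show "distinct vs" using that distinct_disjoint_cycles(1) by (simp add: distinct_concat_iff)
  qed (use arcs_disjoint_cycles[OF that] in \<open>simp_all add: PSG_def\<close>)
  then have "10 \<le> card S"
    using length_le_card_hitting_set[of S disjoint_cycles] distinct_disjoint_cycles S(1)
      finite_subset[OF S(1)] by simp
  moreover have "cycle_transversal_number (PSG 4) \<le> 10"
    using cycle_transversal_number_le[OF _ meets_all_cycles_backward_vertices]
    by (simp add: card_backward_vertices) (simp add: backward_vertices_def)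
  ultimately show ?thesis using S(3) by simp
qed

theorem proposition29:
  shows "cycle_transversal_number (PSG 4) = 10 \<and>
         max_acyclic_number (PSG 4) = fact 4 - cycle_transversal_number (PSG 4) \<and>
         fact 4 - cycle_transversal_number (PSG 4) = 14"
proof -
  have "card (verts (PSG 4)) = fact 4" by (simp add: verts_PSG)
  then have "max_acyclic_number (PSG 4) = fact 4 - cycle_transversal_number (PSG 4)"
    using fin_digraph.max_acyclic_number_eq[OF fin_digraph_PSG, of 4] by simp
  then show ?thesis by (simp add: cycle_transversal_number_PSG_4 fact_numeral)
qed

end
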